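(* Let $\alpha=(b_{0,0},b_{0,1},b_{1,1},b_{1,2},b)$ and $\alpha'=(b_{0,0}',b_{0,1}',b_{1,1}',b_{1,2}',b')$ with $b_{i,j},b_{i,j}'\in\mathbb{C}$ and $b,b'\in\{0,1\}$. The algebras $L(\alpha)$ and $L(\alpha')$ from $CE(\mu_5)$ are isomorphic if and only if there exist $A_0,A_1,B_1,B_2,B_3\in\mathbb{C}$ with $A_0B_1(A_0+A_1b)\neq0$ such that $$b_{0,0}'=\frac{A_0^2b_{0,0}+A_0A_1b_{0,1}+A_1^2b_{1,1}}{A_0^3B_1(A_0+A_1b)},\qquad b_{0,1}'=\frac{A_0b_{0,1}+2A_1b_{1,1}}{A_0^3(A_0+A_1b)},\qquad b_{1,1}'=\frac{B_1b_{1,1}}{A_0^3(A_0+A_1b)},$$ $$b_{1,2}'=\frac{B_1^2b_{1,2}+(-2B_1B_3+B_2^2)b}{A_0^2B_1(A_0+A_1b)},\qquad b'=\frac{B_1b}{A_0+A_1b}.$$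
   Context: A Leibniz algebra over $\mathbb{C}$ is a complex vector space with a bilinear bracket satisfying $[x,[y,z]]=[[x,y],z]-[[x,z],y]$. $CE(\mu_5)$ (one-dimensional Leibniz central extensions of the 5-dimensional naturally graded filiform Lie algebra $\mu_5$) is the class of the 6-dimensional complex Leibniz algebras $L(\alpha)$, $\alpha=(b_{0,0},b_{0,1},b_{1,1},b_{1,2},b)$ with $b_{i,j}\in\mathbb{C}$, $b\in\{0,1\}$, with basis $e_0,\dots,e_5$ and brackets $[e_i,e_0]=e_{i+1}$ ($1\le i\le 4$), $[e_0,e_i]=-e_{i+1}$ ($2\le i\le 4$), $[e_0,e_0]=b_{0,0}e_5$, $[e_0,e_1]=-e_2+b_{0,1}e_5$, $[e_1,e_1]=b_{1,1}e_5$, $[e_1,e_2]=-[e_2,e_1]=b_{1,2}e_5$, $[e_1,e_4]=-[e_4,e_1]=-b\,e_5$, $[e_2,e_3]=-[e_3,e_2]=b\,e_5$, all other brackets of basis vectors being zero. Isomorphic means isomorphic as Leibniz algebras. *)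

theory Defs
  imports "HOL-Analysis.Analysis"
begin

locale leibniz_algebra = vector_space scale
  for scale :: "complex \<Rightarrow> 'a::ab_group_add \<Rightarrow> 'a" +
  fixes bracket :: "'a \<Rightarrow> 'a \<Rightarrow> 'a"
  assumes bracket_add_left: "bracket (x + y) z = bracket x z + bracket y z"
    and bracket_add_right: "bracket x (y + z) = bracket x y + bracket x z"
    and bracket_scale_left: "bracket (scale c x) y = scale c (bracket x y)"
    and bracket_scale_right: "bracket x (scale c y) = scale c (bracket x y)"
    and leibniz: "bracket x (bracket y z) = bracket (bracket x y) z - bracket (bracket x z) y"

locale leibniz_isomorphism =
  dom: leibniz_algebra scale1 bracket1 + cod: leibniz_algebra scale2 bracket2 +
  Vector_Spaces.linear scale1 scale2 f
  for scale1 :: "complex \<Rightarrow> 'a::ab_group_add \<Rightarrow> 'a" and bracket1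
    and scale2 :: "complex \<Rightarrow> 'b::ab_group_add \<Rightarrow> 'b" and bracket2
    and f :: "'a \<Rightarrow> 'b" +
  assumes bij: "bij f"
    and hom: "f (bracket1 x y) = bracket2 (f x) (f y)"

definition leibniz_isomorphic ::
    "(complex \<Rightarrow> 'a::ab_group_add \<Rightarrow> 'a) \<Rightarrow> ('a \<Rightarrow> 'a \<Rightarrow> 'a) \<Rightarrow>
     (complex \<Rightarrow> 'b::ab_group_add \<Rightarrow> 'b) \<Rightarrow> ('b \<Rightarrow> 'b \<Rightarrow> 'b) \<Rightarrow> bool" where
  "leibniz_isomorphic scale1 bracket1 scale2 bracket2 \<longleftrightarrow>
     (\<exists>f. leibniz_isomorphism scale1 bracket1 scale2 bracket2 f)"

text \<open>The elements of the index type \<^typ>\<open>6\<close> are the residues \<open>0, \<dots>, 5\<close> (the numeral 6 is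
  again 0), so they label the basis \<open>e\<^sub>0, \<dots>, e\<^sub>5\<close>.\<close>

definition e :: "6 \<Rightarrow> complex ^ 6" where
  "e i = axis i 1"

type_synonym ce_param = "complex \<times> complex \<times> complex \<times> complex \<times> complex"

text \<open>The bracket of \<open>e i\<close> and \<open>e j\<close> in \<open>L (b00, b01, b11, b12, b)\<close>.\<close>

fun L_basis :: "ce_param \<Rightarrow> 6 \<Rightarrow> 6 \<Rightarrow> complex ^ 6" where
  "L_basis (b00, b01, b11, b12, b) i j =
    (if i \<in> {1, 2, 3, 4} \<and> j = 0 then e (i + 1)
     else if i = 0 \<and> j \<in> {2, 3, 4} then - e (j + 1)
     else if i = 0 \<and> j = 0 then b00 *s e 5
     else if i = 0 \<and> j = 1 then - e 2 + b01 *s e 5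
     else if i = 1 \<and> j = 1 then b11 *s e 5
     else if i = 1 \<and> j = 2 then b12 *s e 5
     else if i = 2 \<and> j = 1 then - (b12 *s e 5)
     else if i = 1 \<and> j = 4 then - (b *s e 5)
     else if i = 4 \<and> j = 1 then b *s e 5
     else if i = 2 \<and> j = 3 then b *s e 5
     else if i = 3 \<and> j = 2 then - (b *s e 5)
     else 0)"

definition L :: "ce_param \<Rightarrow> complex ^ 6 \<Rightarrow> complex ^ 6 \<Rightarrow> complex ^ 6" where
  "L \<alpha> x y = (\<Sum>i\<in>UNIV. \<Sum>j\<in>UNIV. (x $ i * y $ j) *s L_basis \<alpha> i j)"

lemma L_e_e: "L \<alpha> (e i) (e j) = L_basis \<alpha> i j"
proof -
  have "(\<Sum>l\<in>UNIV. (e i $ k * e j $ l) *s L_basis \<alpha> k l) = (if k = i then L_basis \<alpha> i j else 0)" for k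
  proof -
    have "(e i $ k * e j $ l) *s L_basis \<alpha> k l = (if l = j then if k = i then L_basis \<alpha> i j else 0 else 0)" for l
      by (auto simp: e_def axis_def)
    then show ?thesis by simp
  qed
  then show ?thesis by (simp add: L_def)
qed

lemma UNIV_6: "(UNIV :: 6 set) = {0, 1, 2, 3, 4, 5}"
proof -
  have "card {0, 1, 2, 3, 4, 5 :: 6} = CARD(6)" by simp
  then show ?thesis by (metis card_subset_eq finite subset_UNIV)
qed

lemma forall_6: "(\<forall>i::6. P i) \<longleftrightarrow> P 0 \<and> P 1 \<and> P 2 \<and> P 3 \<and> P 4 \<and> P 5"
proof -
  have "(\<forall>i::6. P i) \<longleftrightarrow> (\<forall>i\<in>{0, 1, 2, 3, 4, 5}. P i)" by (simp flip: UNIV_6)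
  then show ?thesis by simp
qed

lemma sum_6: "sum f (UNIV :: 6 set) = f 0 + f 1 + f 2 + f 3 + f 4 + f 5"
  unfolding UNIV_6 by (simp add: add.assoc)

lemma L_components:
  "L (b00, b01, b11, b12, b) x y $ 0 = 0"
  "L (b00, b01, b11, b12, b) x y $ 1 = 0"
  "L (b00, b01, b11, b12, b) x y $ 2 = x $ 1 * y $ 0 - x $ 0 * y $ 1"
  "L (b00, b01, b11, b12, b) x y $ 3 = x $ 2 * y $ 0 - x $ 0 * y $ 2"
  "L (b00, b01, b11, b12, b) x y $ 4 = x $ 3 * y $ 0 - x $ 0 * y $ 3"
  "L (b00, b01, b11, b12, b) x y $ 5 = x $ 4 * y $ 0 - x $ 0 * y $ 4
     + b00 * (x $ 0 * y $ 0) + b01 * (x $ 0 * y $ 1) + b11 * (x $ 1 * y $ 1)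
     + b12 * (x $ 1 * y $ 2 - x $ 2 * y $ 1)
     + b * (x $ 4 * y $ 1 - x $ 1 * y $ 4 + x $ 2 * y $ 3 - x $ 3 * y $ 2)"
  by (simp_all add: L_def sum_6 e_def axis_def algebra_simps)

lemma leibniz_algebra_L: "leibniz_algebra (*s) (L \<alpha>)"
proof -
  obtain b00 b01 b11 b12 b where [simp]: "\<alpha> = (b00, b01, b11, b12, b)"
    by (cases \<alpha>) auto
  show ?thesis
    by unfold_locales
      (simp_all add: vec_eq_iff forall_6 L_components algebra_simps)
qed

end

theory Submission
  imports Defs
begin

text \<open>If \<open>x\<close>, \<open>y\<close> are the images in \<open>L \<alpha>\<close> of the generators \<open>e\<^sub>0\<close>, \<open>e\<^sub>1\<close> of \<open>L \<alpha>'\<close>, the other basis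
  vectors go to the iterated right multiples of \<open>y\<close> by \<open>x\<close>. Transporting \<open>[e\<^sub>1, e\<^sub>2] = b\<^sub>1\<^sub>2' e\<^sub>5\<close> forces
  the \<open>e\<^sub>0\<close>-coordinate of \<open>y\<close> to vanish, and then the five structure constants are read off from the
  \<open>e\<^sub>5\<close>-coordinates, with \<open>A\<^sub>i\<close> and \<open>B\<^sub>i\<close> the coordinates of \<open>x\<close> and \<open>y\<close>. Conversely, the vectors
  \<open>A\<^sub>0 e\<^sub>0 + A\<^sub>1 e\<^sub>1\<close> and \<open>B\<^sub>1 e\<^sub>1 + B\<^sub>2 e\<^sub>2 + B\<^sub>3 e\<^sub>3\<close> generate a basis with the required brackets.\<close>

text \<open>Since \<open>f\<close> is injective, each identity for \<open>inv f\<close> can be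
  checked after applying \<open>f\<close>.\<close>

lemma leibniz_isomorphic_sym:
  assumes "leibniz_isomorphic s1 m1 s2 m2"
  shows "leibniz_isomorphic s2 m2 s1 m1"
proof -
  obtain f where "leibniz_isomorphism s1 m1 s2 m2 f"
    using assms unfolding leibniz_isomorphic_def by blast
  then interpret f: leibniz_isomorphism s1 m1 s2 m2 f .
  have inj: "f u = f v \<longleftrightarrow> u = v" for u v
    using f.bij by (simp add: bij_is_inj inj_eq)
  have inv [simp]: "f (inv f v) = v" for v
    using f.bij by (simp add: bij_is_surj surj_f_inv_f)
  have "leibniz_isomorphism s2 m2 s1 m1 (inv f)"
  proof unfold_locales
    show "bij (inv f)"
      using f.bij by (rule bij_imp_bij_inv)
    show "inv f (u + v) = inv f u + inv f v" for u v
      unfolding inj [symmetric] by (simp add: f.add)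
    show "inv f (s2 c v) = s1 c (inv f v)" for c v
      unfolding inj [symmetric] by (simp add: f.scale)
    show "inv f (m2 u v) = m1 (inv f u) (inv f v)" for u v
      unfolding inj [symmetric] by (simp add: f.hom)
  qed
  then show ?thesis
    unfolding leibniz_isomorphic_def by blast
qed

lemma e_components:
  "e i $ j = (if j = i then 1 else 0)"
  by (simp add: e_def axis_def)

text \<open>Each right bracket with \<open>x\<close> raises the lowest occurring index. The leading
  coefficient starts as a determinant in \<open>y\<close> and \<open>x\<close>, gains the factor
  \<open>x $ 0\<close> twice, and last \<open>x $ 0 + x $ 1 * b\<close>, because \<open>e 4\<close>
  also has bracket \<open>b *s e 5\<close> with \<open>e 1\<close>.\<close>

lemma iterated_bracket:
  assumes "\<alpha> = (b00, b01, b11, b12, b)"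
  shows "L \<alpha> (L \<alpha> (L \<alpha> (L \<alpha> y x) x) x) x =
    ((y $ 1 * x $ 0 - y $ 0 * x $ 1) * x $ 0 ^ 2 * (x $ 0 + x $ 1 * b)) *s e 5"
  unfolding assms
  by (simp add: vec_eq_iff forall_6 L_components e_components power2_eq_square algebra_simps)

lemma isomorphic_L_imp:
  assumes "leibniz_isomorphic (*s) (L (b00, b01, b11, b12, b)) (*s) (L (b00', b01', b11', b12', b'))"
  obtains A0 A1 B1 B2 B3 where
    "A0 * B1 * (A0 + A1 * b) \<noteq> 0"
    "b00' = (A0^2 * b00 + A0 * A1 * b01 + A1^2 * b11) / (A0^3 * B1 * (A0 + A1 * b))"
    "b01' = (A0 * b01 + 2 * A1 * b11) / (A0^3 * (A0 + A1 * b))"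
    "b11' = (B1 * b11) / (A0^3 * (A0 + A1 * b))"
    "b12' = (B1^2 * b12 + (- 2 * B1 * B3 + B2^2) * b) / (A0^2 * B1 * (A0 + A1 * b))"
    "b' = (B1 * b) / (A0 + A1 * b)"
proof -
  define \<alpha> where "\<alpha> = (b00, b01, b11, b12, b)"
  define \<alpha>' where "\<alpha>' = (b00', b01', b11', b12', b')"
  obtain f where "leibniz_isomorphism (*s) (L \<alpha>) (*s) (L \<alpha>') f"
    using assms unfolding leibniz_isomorphic_def \<alpha>_def \<alpha>'_def by blast
  then interpret f: leibniz_isomorphism "(*s)" "L \<alpha>" "(*s)" "L \<alpha>'" f .
  have inj: "u = v" if "f u = f v" for u v
    using f.bij that by (simp add: bij_is_inj inj_eq)
  obtain x y where x: "f x = e 0" and y: "f y = e 1"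
    using f.bij by (metis bij_pointE)
  define y2 where "y2 = L \<alpha> y x"
  define y3 where "y3 = L \<alpha> y2 x"
  define y4 where "y4 = L \<alpha> y3 x"
  define y5 where "y5 = L \<alpha> y4 x"
  have y2: "f y2 = e 2" and y3: "f y3 = e 3" and y4: "f y4 = e 4" and y5: "f y5 = e 5"
    by (simp_all add: y2_def y3_def y4_def y5_def f.hom x y L_e_e \<alpha>'_def)
  define s where "s = (y $ 1 * x $ 0 - y $ 0 * x $ 1) * x $ 0 ^ 2 * (x $ 0 + x $ 1 * b)"
  have y5_eq: "y5 = s *s e 5"
    unfolding y5_def y4_def y3_def y2_def s_def by (rule iterated_bracket [OF \<alpha>_def])
  have "y5 \<noteq> 0"
    using y5 f.zero by (auto simp: e_def)
  then have s: "s \<noteq> 0"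
    by (auto simp: y5_eq)
  \<comment> \<open>These brackets carry the five structure constants of \<open>L \<alpha>'\<close>;
    injectivity of \<open>f\<close> pulls them back to \<open>L \<alpha>\<close>.\<close>
  have rel: "L \<alpha> x x = b00' *s y5" "L \<alpha> x y = - y2 + b01' *s y5" "L \<alpha> y y = b11' *s y5"
    "L \<alpha> y y2 = b12' *s y5" "L \<alpha> y4 y = b' *s y5"
    by (rule inj; simp add: f.hom f.add f.neg f.diff f.scale x y y2 y4 y5 L_e_e \<alpha>'_def)+
  note comps = \<alpha>_def y5_eq y4_def y3_def y2_def L_components e_components
  have y0: "y $ 0 = 0"
  proof -
    \<comment> \<open>Multiples of \<open>y5\<close> have no \<open>e 3\<close>-coordinate, and the
      second factor here divides \<open>s\<close>, which is nonzero.\<close>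
    have "y $ 0 * (y $ 1 * x $ 0 - y $ 0 * x $ 1) = 0"
      using arg_cong [OF rel(4), of "\<lambda>v. v $ 3"] by (simp add: comps)
    then show ?thesis
      using s by (auto simp: s_def)
  qed
  show thesis
  \<comment> \<open>The values are those of \<open>A0\<close>, \<open>B1\<close>, \<open>A1\<close>,
    \<open>B3\<close>, \<open>B2\<close>, in order of first occurrence in the conditions.\<close>
  proof (rule that [of "x $ 0" "y $ 1" "x $ 1" "y $ 3" "y $ 2"])
    show nz: "x $ 0 * y $ 1 * (x $ 0 + x $ 1 * b) \<noteq> 0"
      using s by (simp add: s_def y0)
    have s_eq: "s = x $ 0 ^ 3 * y $ 1 * (x $ 0 + x $ 1 * b)"
      by (simp add: s_def y0 power2_eq_square power3_eq_cube)
    have "b00' * s = x $ 0 ^ 2 * b00 + x $ 0 * x $ 1 * b01 + x $ 1 ^ 2 * b11"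
      using arg_cong [OF rel(1), of "\<lambda>v. v $ 5"]
      by (simp add: comps power2_eq_square algebra_simps)
    then show "b00' = (x $ 0 ^ 2 * b00 + x $ 0 * x $ 1 * b01 + x $ 1 ^ 2 * b11) /
        (x $ 0 ^ 3 * y $ 1 * (x $ 0 + x $ 1 * b))"
      using nz by (simp add: s_eq eq_divide_eq)
    \<comment> \<open>In \<open>L \<alpha> x y + y2\<close> the skew terms cancel and the
      \<open>b11\<close> term doubles. The common factor \<open>y $ 1\<close>, present in
      \<open>s\<close>, is then cancelled by \<open>nz\<close>.\<close>
    have "y $ 1 * (b01' * (x $ 0 ^ 3 * (x $ 0 + x $ 1 * b))) = y $ 1 * (x $ 0 * b01 + 2 * x $ 1 * b11)"
      using arg_cong [OF rel(2), of "\<lambda>v. v $ 5"]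
      by (simp add: comps y0 s_eq power3_eq_cube algebra_simps)
    then show "b01' = (x $ 0 * b01 + 2 * x $ 1 * b11) / (x $ 0 ^ 3 * (x $ 0 + x $ 1 * b))"
      using nz by (simp add: eq_divide_eq)
    have "y $ 1 * (b11' * (x $ 0 ^ 3 * (x $ 0 + x $ 1 * b))) = y $ 1 * (y $ 1 * b11)"
      using arg_cong [OF rel(3), of "\<lambda>v. v $ 5"] by (simp add: comps y0 s_eq power3_eq_cube algebra_simps)
    then show "b11' = (y $ 1 * b11) / (x $ 0 ^ 3 * (x $ 0 + x $ 1 * b))"
      using nz by (simp add: eq_divide_eq)
    have "x $ 0 * (b12' * (x $ 0 ^ 2 * y $ 1 * (x $ 0 + x $ 1 * b))) =
        x $ 0 * (y $ 1 ^ 2 * b12 + (- 2 * y $ 1 * y $ 3 + y $ 2 ^ 2) * b)"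
      using arg_cong [OF rel(4), of "\<lambda>v. v $ 5"]
      by (simp add: comps y0 s_eq power2_eq_square power3_eq_cube algebra_simps)
    then show "b12' = (y $ 1 ^ 2 * b12 + (- 2 * y $ 1 * y $ 3 + y $ 2 ^ 2) * b) /
        (x $ 0 ^ 2 * y $ 1 * (x $ 0 + x $ 1 * b))"
      using nz by (simp add: eq_divide_eq)
    have "x $ 0 ^ 3 * y $ 1 * (b' * (x $ 0 + x $ 1 * b)) = x $ 0 ^ 3 * y $ 1 * (y $ 1 * b)"
      using arg_cong [OF rel(5), of "\<lambda>v. v $ 5"]
      by (simp add: comps y0 s_eq power3_eq_cube algebra_simps)
    then show "b' = (y $ 1 * b) / (x $ 0 + x $ 1 * b)"
      using nz by (simp add: eq_divide_eq)
  qed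
qed

lemma isomorphic_LI:
  assumes nz: "A0 * B1 * (A0 + A1 * b) \<noteq> 0"
    and b00': "b00' = (A0^2 * b00 + A0 * A1 * b01 + A1^2 * b11) / (A0^3 * B1 * (A0 + A1 * b))"
    and b01': "b01' = (A0 * b01 + 2 * A1 * b11) / (A0^3 * (A0 + A1 * b))"
    and b11': "b11' = (B1 * b11) / (A0^3 * (A0 + A1 * b))"
    and b12': "b12' = (B1^2 * b12 + (- 2 * B1 * B3 + B2^2) * b) / (A0^2 * B1 * (A0 + A1 * b))"
    and b': "b' = (B1 * b) / (A0 + A1 * b)"
  shows "leibniz_isomorphic (*s) (L (b00, b01, b11, b12, b)) (*s) (L (b00', b01', b11', b12', b'))"
\<comment> \<open>The parameters are coordinates of vectors in \<open>L \<alpha>\<close>, so the map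
  is built from \<open>L \<alpha>'\<close> to \<open>L \<alpha>\<close>.\<close>
proof (rule leibniz_isomorphic_sym)
  define \<alpha> where "\<alpha> = (b00, b01, b11, b12, b)"
  define \<alpha>' where "\<alpha>' = (b00', b01', b11', b12', b')"
  define x where "x = A0 *s e 0 + A1 *s e 1"
  define y where "y = B1 *s e 1 + B2 *s e 2 + B3 *s e 3"
  define y2 where "y2 = L \<alpha> y x"
  define y3 where "y3 = L \<alpha> y2 x"
  define y4 where "y4 = L \<alpha> y3 x"
  \<comment> \<open>By \<open>iterated_bracket\<close>, \<open>s *s e 5\<close> is
    \<open>L \<alpha> y4 x\<close>, the required image of \<open>e 5\<close>.\<close>
  define s where "s = A0^3 * B1 * (A0 + A1 * b)"
  define g where "g v = v $ 0 *s x + v $ 1 *s y + v $ 2 *s y2 + v $ 3 *s y3 + v $ 4 *s y4 +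
    (v $ 5 * s) *s e 5" for v :: "complex ^ 6"
  have x: "x $ 0 = A0" "x $ 1 = A1" "x $ 2 = 0" "x $ 3 = 0" "x $ 4 = 0" "x $ 5 = 0"
    by (simp_all add: x_def e_components)
  have y: "y $ 0 = 0" "y $ 1 = B1" "y $ 2 = B2" "y $ 3 = B3" "y $ 4 = 0" "y $ 5 = 0"
    by (simp_all add: y_def e_components)
  have y2: "y2 $ 0 = 0" "y2 $ 1 = 0" "y2 $ 2 = A0 * B1" "y2 $ 3 = A0 * B2" "y2 $ 4 = A0 * B3"
    "y2 $ 5 = b11 * A1 * B1 - b12 * A1 * B2"
    by (simp_all add: y2_def \<alpha>_def L_components x y)
  have y3: "y3 $ 0 = 0" "y3 $ 1 = 0" "y3 $ 2 = 0" "y3 $ 3 = A0^2 * B1" "y3 $ 4 = A0^2 * B2"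
    "y3 $ 5 = A0^2 * B3 - b12 * A0 * A1 * B1 + b * A0 * A1 * B3"
    by (simp_all add: y3_def \<alpha>_def L_components x y2 power2_eq_square)
  have y4: "y4 $ 0 = 0" "y4 $ 1 = 0" "y4 $ 2 = 0" "y4 $ 3 = 0" "y4 $ 4 = A0^3 * B1"
    "y4 $ 5 = A0^3 * B2 + b * A0^2 * A1 * B2"
    by (simp_all add: y4_def \<alpha>_def L_components x y3 power2_eq_square power3_eq_cube)
  have g:
    "g v $ 0 = A0 * v $ 0"
    "g v $ 1 = A1 * v $ 0 + B1 * v $ 1"
    "g v $ 2 = B2 * v $ 1 + A0 * B1 * v $ 2"
    "g v $ 3 = B3 * v $ 1 + A0 * B2 * v $ 2 + A0^2 * B1 * v $ 3"
    "g v $ 4 = A0 * B3 * v $ 2 + A0^2 * B2 * v $ 3 + A0^3 * B1 * v $ 4"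
    "g v $ 5 = y2 $ 5 * v $ 2 + y3 $ 5 * v $ 3 + y4 $ 5 * v $ 4 + s * v $ 5" for v
    by (simp_all add: g_def e_components x y y2 y3 y4)
  have s: "s \<noteq> 0"
    using nz by (simp add: s_def)
  have s_rel:
    "s * b00' = A0^2 * b00 + A0 * A1 * b01 + A1^2 * b11"
    "s * b01' = B1 * (A0 * b01 + 2 * A1 * b11)"
    "s * b11' = B1^2 * b11"
    "s * b12' = A0 * (B1^2 * b12 + (- 2 * B1 * B3 + B2^2) * b)"
    "s * b' = A0^3 * B1^2 * b"
    using nz by (simp_all add: s_def b00' b01' b11' b12' b' power2_eq_square power3_eq_cube)
  \<comment> \<open>Distributing \<open>s\<close> exposes the products that \<open>s_rel\<close>
    replaces by polynomials, so the \<open>e 5\<close>-coordinate of the homomorphism law becomes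
    free of division.\<close>
  have s5: "s * L \<alpha>' u v $ 5 = s * (u $ 4 * v $ 0 - u $ 0 * v $ 4)
     + s * b00' * (u $ 0 * v $ 0) + s * b01' * (u $ 0 * v $ 1) + s * b11' * (u $ 1 * v $ 1)
     + s * b12' * (u $ 1 * v $ 2 - u $ 2 * v $ 1)
     + s * b' * (u $ 4 * v $ 1 - u $ 1 * v $ 4 + u $ 2 * v $ 3 - u $ 3 * v $ 2)" for u v
    unfolding \<alpha>'_def L_components by (simp only: distrib_left mult.assoc)
  have hom: "g (L \<alpha>' u v) = L \<alpha> (g u) (g v)" for u v
  proof -
    have "g (L \<alpha>' u v) $ 5 = L \<alpha> (g u) (g v) $ 5"
      unfolding g(6) s5 s_rel unfolding \<alpha>_def \<alpha>'_def L_components g y2 y3 y4 s_def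
      by algebra
    then show ?thesis
      by (simp add: vec_eq_iff forall_6 g(1-5))
        (simp add: \<alpha>_def \<alpha>'_def L_components g power2_eq_square power3_eq_cube algebra_simps)
  qed
  have lin: "Vector_Spaces.linear (*s) (*s) g"
    by unfold_locales (simp_all add: vec_eq_iff forall_6 g algebra_simps)
  have "inj g"
  \<comment> \<open>The matrix of \<open>g\<close> is lower triangular with nonzero diagonal, so a
    kernel vector vanishes coordinate by coordinate.\<close>
  proof (subst vec.linear_inj_iff_eq_0 [OF lin], intro allI impI)
    fix v assume "g v = 0"
    then have "g v $ i = 0" for i by simp
    from this[of 0] this[of 1] this[of 2] this[of 3] this[of 4] this[of 5] show "v = 0"
      using nz s by (simp add: vec_eq_iff forall_6 g)
  qed
  then have "bij g"
    using vec.linear_injective_imp_surjective [OF lin] by (simp add: bij_def)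
  with lin hom have "leibniz_isomorphism (*s) (L \<alpha>') (*s) (L \<alpha>) g"
    by (intro leibniz_isomorphism.intro leibniz_isomorphism_axioms.intro leibniz_algebra_L)
  then show "leibniz_isomorphic (*s) (L (b00', b01', b11', b12', b')) (*s) (L (b00, b01, b11, b12, b))"
    unfolding leibniz_isomorphic_def \<alpha>_def \<alpha>'_def by blast
qed

theorem theorem3p2:
  fixes b00 b01 b11 b12 b b00' b01' b11' b12' b' :: complex
  assumes "b \<in> {0, 1}" and "b' \<in> {0, 1}"
  shows "leibniz_isomorphic (*s) (L (b00, b01, b11, b12, b)) (*s) (L (b00', b01', b11', b12', b'))
    \<longleftrightarrow>
    (\<exists>A0 A1 B1 B2 B3 :: complex.
       A0 * B1 * (A0 + A1 * b) \<noteq> 0 \<and>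
       b00' = (A0^2 * b00 + A0 * A1 * b01 + A1^2 * b11) / (A0^3 * B1 * (A0 + A1 * b)) \<and>
       b01' = (A0 * b01 + 2 * A1 * b11) / (A0^3 * (A0 + A1 * b)) \<and>
       b11' = (B1 * b11) / (A0^3 * (A0 + A1 * b)) \<and>
       b12' = (B1^2 * b12 + (- 2 * B1 * B3 + B2^2) * b) / (A0^2 * B1 * (A0 + A1 * b)) \<and>
       b' = (B1 * b) / (A0 + A1 * b))"
    (is "?iso \<longleftrightarrow> ?rhs")
proof
  assume ?iso
  then show ?rhs by (rule isomorphic_L_imp) blast
next
  assume ?rhs
  then show ?iso by (elim exE conjE) (rule isomorphic_LI)
qed

end
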